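(* Fix $\lambda \in \mathbb{R}$, and suppose $\mu_k > 0$ and $\theta_k \in [0,2\pi)$, $k \in \{0,1,\ldots,n\}$, are related to $x = (x_k)_{k=0}^{n+1}$ by $$x_k = \mu_k \sin\theta_k, \qquad r_k \Delta_h x_k = \mu_k\cos\theta_k, \qquad k \in \{0,1,\ldots,n\}.$$ Then $x$ is a nontrivial solution of the boundary value problem $$\begin{cases}\Delta_h(r_k\Delta_h x_k) + (\lambda w_k - q_k)x_{k+1} = 0, & k = 0,\ldots,n-1,\\ x_0 = x_{n+1} = 0,\end{cases}$$ if and only if $\mu_k$ and $\theta_k$ satisfy, for $k = 0,\ldots,n-1$, $$\Delta_h\mu_k = -\mu_k\Bigg(\frac{h_k\bigl[(\Delta_h\sin\theta_k)^2 + (\Delta_h\cos\theta_k)^2\bigr]}{2}-\frac{1}{r_k}\sin\theta_{k+1}\cos\theta_k + \frac{(\lambda w_k-q_k)\, h_k}{r_k}\cos\theta_{k+1}\cos\theta_{k} + (\lambda w_k-q_k)\cos\theta_{k+1}\sin\theta_k\Bigg)$$ and $$\sin\bigl(h_k\,\Delta_h\theta_k\bigr) = \frac{h_k}{r_k}\Bigl(\cos\theta_k\cos\theta_{k+1} + (\lambda w_k-q_k)\,h_k\cos\theta_k\sin\theta_{k+1}+ (\lambda w_k-q_k)\,r_k\sin\theta_k\sin\theta_{k+1}\Bigr).$$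
   Context: Let $n \ge 1$ be an integer and let $\{t_k\}$ be a grid of real points with step sizes $h_k = t_{k+1}-t_k > 0$, which may vary with $k$. For a sequence $f$, the non-uniform difference operator is $\Delta_h f_k = \dfrac{f_{k+1}-f_k}{t_{k+1}-t_k} = \dfrac{f_{k+1}-f_k}{h_k}$; in particular $\Delta_h(r_k\Delta_h x_k) = \dfrac{r_{k+1}\Delta_h x_{k+1} - r_k\Delta_h x_k}{h_k}$, $\Delta_h\sin\theta_k = (\sin\theta_{k+1}-\sin\theta_k)/h_k$, $\Delta_h\cos\theta_k = (\cos\theta_{k+1}-\cos\theta_k)/h_k$ and $h_k\Delta_h\theta_k = \theta_{k+1}-\theta_k$. The coefficients $r_k, w_k, q_k$ are real sequences with $r_k \ne 0$ and $w_k > 0$ for all $k$. A solution is nontrivial if it is not identically zero.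
   Formalization: The two recurrences do not imply x_0 = x_{n+1} = 0, so these boundary conditions are added to the recurrence side of the equivalence; the recurrences alone are shown to give that x is nontrivial and solves the difference equation. *)

theory Defs
  imports Complex_Main
begin

definition step :: "(nat \<Rightarrow> real) \<Rightarrow> nat \<Rightarrow> real" where
  "step t k = t (Suc k) - t k"

definition ndiff :: "(nat \<Rightarrow> real) \<Rightarrow> (nat \<Rightarrow> real) \<Rightarrow> nat \<Rightarrow> real" where
  "ndiff t f k = (f (Suc k) - f k) / (t (Suc k) - t k)"

text \<open>Finite sequences are total functions on the naturals of which only the values at the relevant
  indices matter: \<open>0..n+1\<close> for the grid \<open>t\<close> and for \<open>x\<close>, \<open>0..n\<close> for \<open>r\<close>, \<open>\<mu>\<close> and \<open>\<theta>\<close>, and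
  \<open>0..n-1\<close> for \<open>w\<close> and \<open>q\<close>.\<close>

definition solves_difference_eq ::
  "nat \<Rightarrow> (nat \<Rightarrow> real) \<Rightarrow> (nat \<Rightarrow> real) \<Rightarrow> (nat \<Rightarrow> real) \<Rightarrow> (nat \<Rightarrow> real) \<Rightarrow> real \<Rightarrow> (nat \<Rightarrow> real) \<Rightarrow> bool"
where
  "solves_difference_eq n t r w q lam x \<longleftrightarrow>
     (\<forall>k<n. ndiff t (\<lambda>j. r j * ndiff t x j) k + (lam * w k - q k) * x (Suc k) = 0)"

text \<open>The recurrences for \<open>\<mu>\<close> and \<open>\<theta>\<close> below do not determine the boundary values (any solution of the
  difference equation gives rise to them), so the boundary conditions are a separate predicate that
  the theorem carries along unchanged.\<close>

definition boundary_conditions :: "nat \<Rightarrow> (nat \<Rightarrow> real) \<Rightarrow> bool" where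
  "boundary_conditions n x \<longleftrightarrow> x 0 = 0 \<and> x (n + 1) = 0"

definition nontrivial :: "nat \<Rightarrow> (nat \<Rightarrow> real) \<Rightarrow> bool" where
  "nontrivial n x \<longleftrightarrow> (\<exists>k\<le>n + 1. x k \<noteq> 0)"

definition nontrivial_bvp_solution ::
  "nat \<Rightarrow> (nat \<Rightarrow> real) \<Rightarrow> (nat \<Rightarrow> real) \<Rightarrow> (nat \<Rightarrow> real) \<Rightarrow> (nat \<Rightarrow> real) \<Rightarrow> real \<Rightarrow> (nat \<Rightarrow> real) \<Rightarrow> bool"
where
  "nontrivial_bvp_solution n t r w q lam x \<longleftrightarrow>
     solves_difference_eq n t r w q lam x \<and> boundary_conditions n x \<and> nontrivial n x"

definition pruefer_radius_eq ::
  "(nat \<Rightarrow> real) \<Rightarrow> (nat \<Rightarrow> real) \<Rightarrow> (nat \<Rightarrow> real) \<Rightarrow> (nat \<Rightarrow> real) \<Rightarrow> real \<Rightarrow>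
   (nat \<Rightarrow> real) \<Rightarrow> (nat \<Rightarrow> real) \<Rightarrow> nat \<Rightarrow> bool"
where
  "pruefer_radius_eq t r w q lam \<mu> \<theta> k \<longleftrightarrow>
     ndiff t \<mu> k =
       - \<mu> k *
         (step t k * ((ndiff t (\<lambda>j. sin (\<theta> j)) k)\<^sup>2 + (ndiff t (\<lambda>j. cos (\<theta> j)) k)\<^sup>2) / 2
          - 1 / r k * sin (\<theta> (k + 1)) * cos (\<theta> k)
          + (lam * w k - q k) * step t k / r k * cos (\<theta> (k + 1)) * cos (\<theta> k)
          + (lam * w k - q k) * cos (\<theta> (k + 1)) * sin (\<theta> k))"

definition pruefer_angle_eq ::
  "(nat \<Rightarrow> real) \<Rightarrow> (nat \<Rightarrow> real) \<Rightarrow> (nat \<Rightarrow> real) \<Rightarrow> (nat \<Rightarrow> real) \<Rightarrow> real \<Rightarrow>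
   (nat \<Rightarrow> real) \<Rightarrow> nat \<Rightarrow> bool"
where
  "pruefer_angle_eq t r w q lam \<theta> k \<longleftrightarrow>
     sin (step t k * ndiff t \<theta> k) =
       step t k / r k *
         (cos (\<theta> k) * cos (\<theta> (k + 1))
          + (lam * w k - q k) * step t k * cos (\<theta> k) * sin (\<theta> (k + 1))
          + (lam * w k - q k) * r k * sin (\<theta> k) * sin (\<theta> (k + 1)))"

end

theory Submission
  imports Defs
begin

text \<open>
  Fix \<open>k < n\<close> and let \<open>\<delta>\<close> be the left-hand side of the difference equation at \<open>k\<close>, multiplied by
  the step size and written in the polar coordinates \<open>\<mu>\<close>, \<open>\<theta>\<close> (\<open>polar_residual\<close>).
  The difference equation at \<open>k\<close> says \<open>\<delta> = 0\<close>.  The two polar relations at \<open>k\<close> and the first one at \<open>k + 1\<close> express \<open>x (k + 1)\<close> in two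
  ways, which gives the identity
  \<open>\<mu>\<^sub>k\<^sub>+\<^sub>1 sin \<theta>\<^sub>k\<^sub>+\<^sub>1 = \<mu>\<^sub>k (sin \<theta>\<^sub>k + (h\<^sub>k / r\<^sub>k) cos \<theta>\<^sub>k)\<close>, whether or not \<open>x\<close> solves the equation.  Modulo this
  identity the radius equation is \<open>\<delta> cos \<theta>\<^sub>k\<^sub>+\<^sub>1 = 0\<close> and the angle equation is \<open>\<delta> sin \<theta>\<^sub>k\<^sub>+\<^sub>1 = 0\<close>: they
  say that the two components of the plane vector \<open>\<delta> (sin \<theta>\<^sub>k\<^sub>+\<^sub>1, cos \<theta>\<^sub>k\<^sub>+\<^sub>1)\<close> vanish.  Sine and cosine have no common zero, so
  the two equations together are equivalent to \<open>\<delta> = 0\<close>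
  (\<open>radius_and_angle_iff_residual_zero\<close>).

  Nontriviality holds for every \<open>x\<close> with such a polar representation: if \<open>x 0 = x 1 = 0\<close> then
  both \<open>\<mu>\<^sub>0 sin \<theta>\<^sub>0\<close> and \<open>\<mu>\<^sub>0 cos \<theta>\<^sub>0\<close> vanish, against \<open>\<mu>\<^sub>0 > 0\<close>.
\<close>

definition polar_residual ::
  "(nat \<Rightarrow> real) \<Rightarrow> (nat \<Rightarrow> real) \<Rightarrow> (nat \<Rightarrow> real) \<Rightarrow> real \<Rightarrow>
   (nat \<Rightarrow> real) \<Rightarrow> (nat \<Rightarrow> real) \<Rightarrow> nat \<Rightarrow> real"
where
  "polar_residual t w q lam \<mu> \<theta> k =
     \<mu> (Suc k) * cos (\<theta> (Suc k)) - \<mu> k * cos (\<theta> k)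
     + step t k * (lam * w k - q k) * (\<mu> (Suc k) * sin (\<theta> (Suc k)))"

lemma chord_length_squared:
  fixes a b :: real
  shows "(sin b - sin a)\<^sup>2 + (cos b - cos a)\<^sup>2 = 2 * (1 - (sin b * sin a + cos b * cos a))"
proof -
  have "(sin b - sin a)\<^sup>2 + (cos b - cos a)\<^sup>2
      = ((sin b)\<^sup>2 + (cos b)\<^sup>2) + ((sin a)\<^sup>2 + (cos a)\<^sup>2) - 2 * (sin b * sin a + cos b * cos a)"
    by (simp add: power2_eq_square algebra_simps del: sin_cos_squared_add sin_cos_squared_add2)
  also have "\<dots> = 2 * (1 - (sin b * sin a + cos b * cos a))"
    by simp
  finally show ?thesis .
qed

lemma polar_step:
  assumes "step t k > 0" "r k \<noteq> 0"
    and "x k = \<mu> k * sin (\<theta> k)" "x (Suc k) = \<mu> (Suc k) * sin (\<theta> (Suc k))"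
    and "r k * ndiff t x k = \<mu> k * cos (\<theta> k)"
  shows "\<mu> (Suc k) * sin (\<theta> (Suc k)) = \<mu> k * (sin (\<theta> k) + step t k / r k * cos (\<theta> k))"
proof -
  have "x (Suc k) - x k = step t k / r k * (r k * ndiff t x k)"
    using assms(1,2) by (simp add: ndiff_def step_def)
  also have "\<dots> = step t k / r k * (\<mu> k * cos (\<theta> k))"
    by (simp only: assms(5))
  finally show ?thesis
    using assms(3,4) by (simp add: algebra_simps)
qed

lemma difference_eq_iff_residual_zero:
  assumes "step t k > 0"
    and "x (Suc k) = \<mu> (Suc k) * sin (\<theta> (Suc k))"
    and "r k * ndiff t x k = \<mu> k * cos (\<theta> k)"
    and "r (Suc k) * ndiff t x (Suc k) = \<mu> (Suc k) * cos (\<theta> (Suc k))"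
  shows "ndiff t (\<lambda>j. r j * ndiff t x j) k + (lam * w k - q k) * x (Suc k) = 0
      \<longleftrightarrow> polar_residual t w q lam \<mu> \<theta> k = 0"
proof -
  have "step t k * ndiff t (\<lambda>j. r j * ndiff t x j) k
      = \<mu> (Suc k) * cos (\<theta> (Suc k)) - \<mu> k * cos (\<theta> k)"
    unfolding ndiff_def[of t "\<lambda>j. r j * ndiff t x j"] assms(3,4)
    using assms(1) by (simp add: step_def)
  then have residual: "polar_residual t w q lam \<mu> \<theta> k
      = step t k * (ndiff t (\<lambda>j. r j * ndiff t x j) k + (lam * w k - q k) * x (Suc k))"
    unfolding distrib_left polar_residual_def by (simp only: assms(2) mult.assoc)
  have "step t k \<noteq> 0"
    using assms(1) by simp
  then show ?thesis
    unfolding residual by (simp only: mult_eq_0_iff simp_thms)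
qed

text \<open>
  The squared differences in the radius equation form the squared chord between the directions
  \<open>\<theta>\<^sub>k\<close> and \<open>\<theta>\<^sub>k\<^sub>+\<^sub>1\<close>.  Once the chord is expanded, the term \<open>\<mu>\<^sub>k\<close> cancels and the equation expresses
  \<open>\<mu>\<^sub>k\<^sub>+\<^sub>1\<close> as a linear combination of \<open>sin \<theta>\<^sub>k\<^sub>+\<^sub>1\<close> and \<open>cos \<theta>\<^sub>k\<^sub>+\<^sub>1\<close>.  By the assumed identity the sine
  part is \<open>\<mu>\<^sub>k\<^sub>+\<^sub>1 sin\<^sup>2 \<theta>\<^sub>k\<^sub>+\<^sub>1\<close>; moved to the left, it leaves \<open>\<mu>\<^sub>k\<^sub>+\<^sub>1 cos\<^sup>2 \<theta>\<^sub>k\<^sub>+\<^sub>1\<close> there, and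
  \<open>cos \<theta>\<^sub>k\<^sub>+\<^sub>1\<close> becomes a common factor.
\<close>
lemma radius_eq_iff_cos_mult_residual_zero:
  assumes h: "step t k > 0"
    and A: "\<mu> (Suc k) * sin (\<theta> (Suc k)) = \<mu> k * (sin (\<theta> k) + step t k / r k * cos (\<theta> k))"
  shows "pruefer_radius_eq t r w q lam \<mu> \<theta> k
      \<longleftrightarrow> cos (\<theta> (Suc k)) * polar_residual t w q lam \<mu> \<theta> k = 0"
proof -
  define h p s c S C m M
    where "h = step t k" and "p = lam * w k - q k"
      and "s = sin (\<theta> k)" and "c = cos (\<theta> k)"
      and "S = sin (\<theta> (Suc k))" and "C = cos (\<theta> (Suc k))"
      and "m = \<mu> k" and "M = \<mu> (Suc k)"
  note d = this
  have h0: "h > 0" and A': "M * S = m * (s + h / r k * c)"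
    using assms by (simp_all add: d)
  have one: "S\<^sup>2 + C\<^sup>2 = 1"
    by (simp add: d)
  have "h * ((ndiff t (\<lambda>j. sin (\<theta> j)) k)\<^sup>2 + (ndiff t (\<lambda>j. cos (\<theta> j)) k)\<^sup>2) / 2
      = h * (((S - s) / h)\<^sup>2 + ((C - c) / h)\<^sup>2) / 2"
    by (simp only: ndiff_def d step_def)
  also have "\<dots> = h * (((S - s)\<^sup>2 + (C - c)\<^sup>2) / h\<^sup>2) / 2"
    by (simp only: power_divide add_divide_distrib)
  also have "\<dots> = ((S - s)\<^sup>2 + (C - c)\<^sup>2) / (2 * h)"
    using h0 by (simp add: power2_eq_square)
  also have "\<dots> = 2 * (1 - (S * s + C * c)) / (2 * h)"
    by (simp only: d chord_length_squared)
  also have "\<dots> = (1 - (S * s + C * c)) / h"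
    by (rule mult_divide_mult_cancel_left) simp
  finally have chord: "h * ((ndiff t (\<lambda>j. sin (\<theta> j)) k)\<^sup>2 + (ndiff t (\<lambda>j. cos (\<theta> j)) k)\<^sup>2) / 2
      = (1 - (S * s + C * c)) / h" .
  have "pruefer_radius_eq t r w q lam \<mu> \<theta> k \<longleftrightarrow>
      (M - m) / h = - m * ((1 - (S * s + C * c)) / h - 1 / r k * S * c + p * h / r k * C * c + p * C * s)"
    unfolding pruefer_radius_eq_def chord[unfolded h_def] ndiff_def[of t \<mu>]
    by (simp add: d step_def)
  also have "\<dots> \<longleftrightarrow>
      M - m = h * (- m * ((1 - (S * s + C * c)) / h - 1 / r k * S * c + p * h / r k * C * c + p * C * s))"
    using h0 by (simp add: divide_eq_eq mult.commute)
  also have "h * (- m * ((1 - (S * s + C * c)) / h - 1 / r k * S * c + p * h / r k * C * c + p * C * s))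
      = S * (m * (s + h / r k * c)) + C * (m * c - h * p * (m * (s + h / r k * c))) - m"
    using h0 by (simp add: algebra_simps add_divide_distrib diff_divide_distrib)
  also have "\<dots> = S * (M * S) + C * (m * c - h * p * (M * S)) - m"
    unfolding A' ..
  also have "M - m = \<dots> \<longleftrightarrow> M * (S\<^sup>2 + C\<^sup>2) = S * (M * S) + C * (m * c - h * p * (M * S))"
    unfolding one by auto
  also have "\<dots> \<longleftrightarrow> C * (M * C - m * c + h * p * (M * S)) = 0"
    by (auto simp: algebra_simps power2_eq_square)
  finally show ?thesis
    by (simp add: polar_residual_def d)
qed

text \<open>
  Here \<open>sin (\<theta>\<^sub>k\<^sub>+\<^sub>1 - \<theta>\<^sub>k)\<close> is expanded by the addition theorem; after multiplication by \<open>\<mu>\<^sub>k\<close>, the terms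
  with the factor \<open>cos \<theta>\<^sub>k\<^sub>+\<^sub>1\<close> add up to \<open>\<mu>\<^sub>k\<^sub>+\<^sub>1 sin \<theta>\<^sub>k\<^sub>+\<^sub>1 cos \<theta>\<^sub>k\<^sub>+\<^sub>1\<close>, so that \<open>sin \<theta>\<^sub>k\<^sub>+\<^sub>1\<close> divides everything.
\<close>
lemma angle_eq_iff_sin_mult_residual_zero:
  assumes h: "step t k > 0" and r: "r k \<noteq> 0" and m: "\<mu> k > 0"
    and A: "\<mu> (Suc k) * sin (\<theta> (Suc k)) = \<mu> k * (sin (\<theta> k) + step t k / r k * cos (\<theta> k))"
  shows "pruefer_angle_eq t r w q lam \<theta> k
      \<longleftrightarrow> sin (\<theta> (Suc k)) * polar_residual t w q lam \<mu> \<theta> k = 0"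
proof -
  define h p s c S C m M
    where "h = step t k" and "p = lam * w k - q k"
      and "s = sin (\<theta> k)" and "c = cos (\<theta> k)"
      and "S = sin (\<theta> (Suc k))" and "C = cos (\<theta> (Suc k))"
      and "m = \<mu> k" and "M = \<mu> (Suc k)"
  note d = this
  have m0: "m \<noteq> 0" and A': "M * S = m * (s + h / r k * c)"
    using assms by (simp_all add: d)
  have "step t k * ndiff t \<theta> k = \<theta> (Suc k) - \<theta> k"
    using h by (simp add: ndiff_def step_def)
  then have "pruefer_angle_eq t r w q lam \<theta> k \<longleftrightarrow>
      S * c - C * s = h / r k * (c * C + p * h * c * S + p * r k * s * S)"
    by (simp add: pruefer_angle_eq_def sin_diff d)
  also have "\<dots> \<longleftrightarrow>
      m * (S * c - C * s) = m * (h / r k * (c * C + p * h * c * S + p * r k * s * S))"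
    using m0 by (simp only: mult_cancel_left simp_thms)
  also have "\<dots> \<longleftrightarrow>
      S * (m * c - h * p * (m * (s + h / r k * c))) = C * (m * (s + h / r k * c))"
    using r by (auto simp: algebra_simps)
  also have "\<dots> \<longleftrightarrow> S * (m * c - h * p * (M * S)) = C * (M * S)"
    unfolding A' ..
  also have "\<dots> \<longleftrightarrow> S * (M * C - m * c + h * p * (M * S)) = 0"
    by (auto simp: algebra_simps)
  finally show ?thesis
    by (simp add: polar_residual_def d)
qed

lemma radius_and_angle_iff_residual_zero:
  assumes "step t k > 0" "r k \<noteq> 0" "\<mu> k > 0"
    and "\<mu> (Suc k) * sin (\<theta> (Suc k)) = \<mu> k * (sin (\<theta> k) + step t k / r k * cos (\<theta> k))"
  shows "pruefer_radius_eq t r w q lam \<mu> \<theta> k \<and> pruefer_angle_eq t r w q lam \<theta> k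
      \<longleftrightarrow> polar_residual t w q lam \<mu> \<theta> k = 0"
proof -
  have "\<not> (sin (\<theta> (Suc k)) = 0 \<and> cos (\<theta> (Suc k)) = 0)"
    using sin_zero_abs_cos_one[of "\<theta> (Suc k)"] by auto
  then show ?thesis
    using assms by (auto simp: radius_eq_iff_cos_mult_residual_zero
      angle_eq_iff_sin_mult_residual_zero)
qed

lemma polar_representation_nontrivial:
  assumes "\<mu> 0 > 0" "x 0 = \<mu> 0 * sin (\<theta> 0)" "r 0 * ndiff t x 0 = \<mu> 0 * cos (\<theta> 0)"
  shows "nontrivial n x"
proof (rule ccontr)
  assume "\<not> nontrivial n x"
  then have "x 0 = 0" "x (Suc 0) = 0"
    by (auto simp: nontrivial_def)
  then have "sin (\<theta> 0) = 0" "cos (\<theta> 0) = 0"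
    using assms by (auto simp: ndiff_def)
  then show False
    using sin_cos_squared_add[of "\<theta> 0"] by simp
qed

theorem theorem1p1:
  fixes n :: nat and lam :: real
    and t r w q \<mu> \<theta> x :: "nat \<Rightarrow> real"
  assumes "n \<ge> 1"
    and "\<forall>k\<le>n. step t k > 0"
    and "\<forall>k\<le>n. r k \<noteq> 0"
    and "\<forall>k<n. w k > 0"
    and "\<forall>k\<le>n. \<mu> k > 0"
    and "\<forall>k\<le>n. \<theta> k \<in> {0..<2 * pi}"
    and "\<forall>k\<le>n. x k = \<mu> k * sin (\<theta> k)"
    and "\<forall>k\<le>n. r k * ndiff t x k = \<mu> k * cos (\<theta> k)"
  shows "(nontrivial_bvp_solution n t r w q lam x \<longleftrightarrow>
            (\<forall>k<n. pruefer_radius_eq t r w q lam \<mu> \<theta> k \<and> pruefer_angle_eq t r w q lam \<theta> k)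
            \<and> boundary_conditions n x)
       \<and> ((\<forall>k<n. pruefer_radius_eq t r w q lam \<mu> \<theta> k \<and> pruefer_angle_eq t r w q lam \<theta> k) \<longrightarrow>
            solves_difference_eq n t r w q lam x \<and> nontrivial n x)"
proof -
  have "ndiff t (\<lambda>j. r j * ndiff t x j) k + (lam * w k - q k) * x (Suc k) = 0 \<longleftrightarrow>
      pruefer_radius_eq t r w q lam \<mu> \<theta> k \<and> pruefer_angle_eq t r w q lam \<theta> k"
    if "k < n" for k
  proof -
    have le: "k \<le> n" "Suc k \<le> n"
      using that by simp_all
    have "\<mu> (Suc k) * sin (\<theta> (Suc k)) = \<mu> k * (sin (\<theta> k) + step t k / r k * cos (\<theta> k))"
      using assms le by (intro polar_step[where x = x]) simp_all
    moreover have "ndiff t (\<lambda>j. r j * ndiff t x j) k + (lam * w k - q k) * x (Suc k) = 0 \<longleftrightarrow>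
        polar_residual t w q lam \<mu> \<theta> k = 0"
      using assms le by (intro difference_eq_iff_residual_zero) simp_all
    ultimately show ?thesis
      using assms le by (simp add: radius_and_angle_iff_residual_zero)
  qed
  then have "solves_difference_eq n t r w q lam x \<longleftrightarrow>
      (\<forall>k<n. pruefer_radius_eq t r w q lam \<mu> \<theta> k \<and> pruefer_angle_eq t r w q lam \<theta> k)"
    by (simp add: solves_difference_eq_def)
  moreover have "nontrivial n x"
    using assms by (intro polar_representation_nontrivial[of \<mu> x \<theta> r t]) simp_all
  ultimately show ?thesis
    by (auto simp: nontrivial_bvp_solution_def)
qed

end
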